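(* Let $A\in\mathbb{C}^{m\times n}$ have rank $a$, let $B\in\mathbb{C}^{p\times q}$ have rank $b$, and let $C\in\mathbb{C}^{m\times q}$. Let $T_{A_r}\in\mathbb{C}^{m\times m}$, $T_{A_c}\in\mathbb{C}^{n\times n}$, $T_{B_r}\in\mathbb{C}^{p\times p}$, $T_{B_c}\in\mathbb{C}^{q\times q}$ be permutation matrices such that the first $a$ rows and the first $a$ columns of $\widehat{A}=T_{A_r}AT_{A_c}$ are linearly independent and the first $b$ rows and the first $b$ columns of $\widehat{B}=T_{B_r}BT_{B_c}$ are linearly independent, and put $\widehat{C}=T_{A_r}CT_{B_c}$. Let $\alpha_{i,l},\alpha'_{k,j},\beta'_{i,l},\beta_{k,j}\in\mathbb{C}$ be scalars such that $$\widehat{A}_{i\rightarrow}=\sum_{l=1}^{a}\alpha_{i,l}\widehat{A}_{l\rightarrow}\ (i=a+1,\dots,m),\qquad \widehat{A}_{\downarrow j}=\sum_{k=1}^{a}\alpha'_{k,j}\widehat{A}_{\downarrow k}\ (j=a+1,\dots,n),$$ $$\widehat{B}_{i\rightarrow}=\sum_{l=1}^{b}\beta'_{i,l}\widehat{B}_{l\rightarrow}\ (i=b+1,\dots,p),\qquad \widehat{B}_{\downarrow j}=\sum_{k=1}^{b}\beta_{k,j}\widehat{B}_{\downarrow k}\ (j=b+1,\dots,q).$$ Then the condition $$AA^{(1)}CB^{(1)}B=C$$ holds for any choice of $\{1\}$-inverses $A^{(1)}$ of $A$ and $B^{(1)}$ of $B$ if and only if there are elements $c_{i,j}\in\mathbb{C}$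 ($1\le i\le a$, $1\le j\le b$), which may be arbitrary, such that the entries of $\widehat{C}$ are $$\widehat{C}_{i,j}=\begin{cases} c_{i,j}, & 1\le i\le a,\ 1\le j\le b,\\ \sum_{k=1}^{b}\beta_{k,j}c_{i,k}, & 1\le i\le a,\ b+1\le j\le q,\\ \sum_{l=1}^{a}\alpha_{i,l}c_{l,j}, & a+1\le i\le m,\ 1\le j\le b,\\ \sum_{l=1}^{a}\sum_{k=1}^{b}\alpha_{i,l}\beta_{k,j}c_{l,k}, & a+1\le i\le m,\ b+1\le j\le q.\end{cases}$$
   Context: A $\{1\}$-inverse of a matrix $M\in\mathbb{C}^{m\times n}$ is any matrix $M^{(1)}\in\mathbb{C}^{n\times m}$ with $MM^{(1)}M=M$. For a matrix $M$, $M_{i\rightarrow}$ denotes its $i$-th row and $M_{\downarrow j}$ its $j$-th column. *)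

theory Defs
  imports Complex_Main "Jordan_Normal_Form.DL_Rank"
begin

definition one_inverse :: "'a :: semiring_0 mat \<Rightarrow> 'a mat \<Rightarrow> bool" where
  "one_inverse M X \<longleftrightarrow> X \<in> carrier_mat (dim_col M) (dim_row M) \<and> M * X * M = M"

definition permutation_mat :: "nat \<Rightarrow> 'a :: {zero, one} mat \<Rightarrow> bool" where
  "permutation_mat n P \<longleftrightarrow>
     (\<exists>\<sigma>. \<sigma> permutes {..<n} \<and> P = mat n n (\<lambda>(i, j). if j = \<sigma> i then 1 else 0))"

text \<open>The predicate \<open>lin_indpt\<close> of the library speaks about a set of vectors, so a repeated
  vector would go unnoticed; distinctness makes this the linear independence of the family.\<close>

definition (in vec_space) lin_indpt_list :: "'a vec list \<Rightarrow> bool" where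
  "lin_indpt_list xs \<longleftrightarrow> set xs \<subseteq> carrier_vec n \<and> distinct xs \<and> lin_indpt (set xs)"

end

theory Submission
  imports Defs
begin

text \<open>
  By Penrose's argument, the condition for all \<open>{1}\<close>-inverses says that \<open>C\<close> has the form
  \<open>A U B\<close>: if \<open>C = A U B\<close>, then \<open>A X A = A\<close> and \<open>B Y B = B\<close> give \<open>A X C Y B = C\<close>; conversely a single
  pair \<open>X\<close>, \<open>Y\<close> gives the witness \<open>U = X C Y\<close> (\<open>one_inverse_condition_iff\<close>). This needs one
  \<open>{1}\<close>-inverse of each matrix to exist, since otherwise the condition would be vacuous.

  Write \<open>R\<close> for the \<open>b \<times> q\<close> block matrix \<open>[I | \<beta>]\<close> and \<open>L\<close> for the \<open>m \<times> a\<close> block matrix with \<open>I\<close> on top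
  of \<open>\<alpha>\<close>. The relations between the columns of \<open>Bh\<close> say \<open>Bh = Bh E R\<close>, where \<open>Bh E\<close> consists of the
  first \<open>b\<close> columns. These are linearly independent, so \<open>Bh E\<close> has a left inverse \<open>W\<close>, and
  then \<open>W Bh = R\<close> (\<open>basis_cols_factorisation\<close>). By transposition \<open>Ah = L S Ah\<close>, where \<open>S Ah\<close> consists of
  the first \<open>a\<close> rows, and \<open>Ah V = L\<close> for some \<open>V\<close> (\<open>basis_rows_factorisation\<close>).

  These identities do everything at once. They give \<open>Ah (V S) Ah = Ah\<close> and \<open>Bh (E W) Bh = Bh\<close>, so
  \<open>{1}\<close>-inverses exist; and they turn \<open>Ah U Bh\<close> into \<open>L (S Ah U Bh E) R\<close> and \<open>L c R\<close> into
  \<open>Ah (V c W) Bh\<close>, so the matrices \<open>Ah U Bh\<close> are the matrices \<open>L c R\<close>. Permutation matrices are invertible,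
  hence \<open>C = A U B\<close> for some \<open>U\<close> exactly if \<open>Ch = Ah U' Bh\<close> for some \<open>U'\<close>. The four cases of the asserted
  formula are the four blocks of \<open>L c R\<close> (\<open>coeff_mat_product_index\<close>).
\<close>

section \<open>Independent columns and left inverses\<close>

text \<open>
  The side conditions are equations between dimensions, which the simplifier can decide for
  arbitrary products; as a rewrite rule this brings every product into right-associated form.
\<close>

lemma mult_mat_assoc:
  fixes A B C :: "'a :: semiring_0 mat"
  assumes "dim_col A = dim_row B" "dim_col B = dim_row C"
  shows "A * B * C = A * (B * C)"
  by (rule assoc_mult_mat[of _ "dim_row A" "dim_col A" _ "dim_col B" _ "dim_col C"])
    (use assms in auto)

text \<open>
  Over the complex numbers, the Gram matrix \<open>H M\<close> with \<open>H\<close> the conjugate transpose of \<open>M\<close> is invertible: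
  a vector \<open>v\<close> in its kernel satisfies \<open>\<parallel>M v\<parallel>\<^sup>2 = \<langle>H M v, v\<rangle> = 0\<close>, hence \<open>M v = 0\<close>, and \<open>v = 0\<close> because the
  columns of \<open>M\<close> are independent. So \<open>(H M)\<^sup>-\<^sup>1 H\<close> is a left inverse.
\<close>

lemma left_inverse_if_lin_indpt_cols:
  fixes M :: "complex mat"
  assumes M: "M \<in> carrier_mat n k" and indpt: "vec_space.lin_indpt_list n (cols M)"
  obtains Z where "Z \<in> carrier_mat k n" "Z * M = 1\<^sub>m k"
proof -
  interpret vec_space "TYPE(complex)" n .
  define H where "H = (map_mat cnj M)\<^sup>T"
  have H: "H \<in> carrier_mat k n"
    using M by (simp add: H_def)
  have HM: "H * M \<in> carrier_mat k k"
    using H M by simp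
  have "det (H * M) \<noteq> 0"
  proof
    assume "det (H * M) = 0"
    then obtain v where v: "v \<in> carrier_vec k" "v \<noteq> 0\<^sub>v k" "(H * M) *\<^sub>v v = 0\<^sub>v k"
      using det_0_iff_vec_prod_zero_field[OF HM] by blast
    have Mv: "M *\<^sub>v v \<in> carrier_vec n"
      using M v by simp
    have "conjugate (M *\<^sub>v v) = H\<^sup>T *\<^sub>v conjugate v"
      using M v(1) by (intro eq_vecI) (auto simp: H_def scalar_prod_def)
    then have "(M *\<^sub>v v) \<bullet>c (M *\<^sub>v v) = (H\<^sup>T *\<^sub>v conjugate v) \<bullet> (M *\<^sub>v v)"
      using comm_scalar_prod[OF Mv carrier_vec_conjugate[OF Mv]] by simp
    also have "\<dots> = conjugate v \<bullet> (H *\<^sub>v (M *\<^sub>v v))"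
      using transpose_vec_mult_scalar[OF H Mv, of "conjugate v"] v(1) by simp
    also have "H *\<^sub>v (M *\<^sub>v v) = 0\<^sub>v k"
      using assoc_mult_mat_vec[OF H M v(1)] v(3) by simp
    finally have "(M *\<^sub>v v) \<bullet>c (M *\<^sub>v v) = 0"
      using v(1) by simp
    then have "M *\<^sub>v v = 0\<^sub>v n"
      using conjugate_square_eq_0_vec[OF Mv] by simp
    then show False
      using lin_depI[OF M v(1,2)] indpt by (auto simp: lin_indpt_list_def)
  qed
  then obtain G where G: "G \<in> carrier_mat k k" "G * (H * M) = 1\<^sub>m k"
    using det_non_zero_imp_unit[OF HM, where b = "()"] by (auto simp: Units_def ring_mat_def)
  show thesis
  proof (rule that)
    show "G * H \<in> carrier_mat k n"
      using G H by simp
    show "G * H * M = 1\<^sub>m k"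
      using G H M by (simp add: assoc_mult_mat[of G k k H n M k])
  qed
qed

section \<open>Factorisation through a basis of columns or rows\<close>

text \<open>
  The first \<open>b\<close> columns of the identity, so that multiplying by it on the right keeps
  the first \<open>b\<close> columns of a matrix.
\<close>

definition selection_mat :: "nat \<Rightarrow> nat \<Rightarrow> 'a :: {zero, one} mat" where
  "selection_mat q b = mat q b (\<lambda>(j, k). if j = k then 1 else 0)"

text \<open>
  The block matrix \<open>[I | \<beta>]\<close>: its column \<open>j\<close> holds the coordinates of the \<open>j\<close>-th column with respect to
  the first \<open>b\<close> columns. The index \<open>j\<close> of \<open>\<beta>\<close> is the position in the full matrix, not
  in the right block, hence no shift by \<open>b\<close>.
\<close>

definition coeff_mat :: "nat \<Rightarrow> nat \<Rightarrow> (nat \<Rightarrow> nat \<Rightarrow> 'a :: {zero, one}) \<Rightarrow> 'a mat" where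
  "coeff_mat b q \<beta> = mat b q (\<lambda>(k, j). if j < b then (if k = j then 1 else 0) else \<beta> k j)"

lemma selection_mat_carrier [simp]: "selection_mat q b \<in> carrier_mat q b"
  by (simp add: selection_mat_def)

lemma coeff_mat_carrier [simp]: "coeff_mat b q \<beta> \<in> carrier_mat b q"
  by (simp add: coeff_mat_def)

lemma cols_mult_selection_mat:
  fixes M :: "'a :: semiring_1 mat"
  assumes M: "M \<in> carrier_mat p q" and b: "b \<le> q"
  shows "cols (M * selection_mat q b) = take b (cols M)"
proof (rule nth_equalityI)
  show "length (cols (M * selection_mat q b)) = length (take b (cols M))"
    using M b by (simp add: selection_mat_def)
  fix k assume "k < length (cols (M * selection_mat q b))"
  then have k: "k < b" by (simp add: selection_mat_def)
  have "col (M * selection_mat q b) k = col M k"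
    using M b k
    by (intro eq_vecI)
      (auto simp: selection_mat_def scalar_prod_def if_distrib[of "(*) _"] cong: if_cong)
  then show "cols (M * selection_mat q b) ! k = take b (cols M) ! k"
    using M b k by (simp add: selection_mat_def)
qed

lemma mult_coeff_mat:
  fixes M :: "'a :: comm_semiring_1 mat"
  assumes M: "M \<in> carrier_mat p q" and b: "b \<le> q"
    and \<beta>: "\<And>j. j \<in> {b..<q} \<Longrightarrow>
      col M j = finsum_vec TYPE('a) p (\<lambda>k. \<beta> k j \<cdot>\<^sub>v col M k) {..<b}"
  shows "M * selection_mat q b * coeff_mat b q \<beta> = M"
proof (rule eq_matI)
  fix i j assume "i < dim_row M" "j < dim_col M"
  then have i: "i < p" and j: "j < q" using M by auto
  have "(M * selection_mat q b * coeff_mat b q \<beta>) $$ (i, j)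
      = (\<Sum>k<b. M $$ (i, k) * coeff_mat b q \<beta> $$ (k, j))"
  proof -
    have "(M * selection_mat q b) $$ (i, k) = M $$ (i, k)" if "k < b" for k
      using M b i that
      by (simp add: selection_mat_def scalar_prod_def if_distrib[of "(*) _"] cong: if_cong)
    then show ?thesis
      using M i j by (simp add: scalar_prod_def lessThan_atLeast0 coeff_mat_def selection_mat_def)
  qed
  also have "\<dots> = M $$ (i, j)"
  proof (cases "j < b")
    case True
    then show ?thesis
      using j by (simp add: coeff_mat_def if_distrib[of "(*) _"] cong: if_cong)
  next
    case False
    have "M $$ (i, j) = col M j $ i"
      using M i j by simp
    also have "\<dots> = (\<Sum>k<b. \<beta> k j * M $$ (i, k))"
    proof -
      have "finsum_vec TYPE('a) p (\<lambda>k. \<beta> k j \<cdot>\<^sub>v col M k) {..<b} $ i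
          = (\<Sum>k<b. (\<beta> k j \<cdot>\<^sub>v col M k) $ i)"
        by (rule index_finsum_vec) (use M i in auto)
      then show ?thesis
        using M i j b False by (simp add: \<beta>)
    qed
    finally show ?thesis
      using False j by (simp add: coeff_mat_def mult.commute)
  qed
  finally show "(M * selection_mat q b * coeff_mat b q \<beta>) $$ (i, j) = M $$ (i, j)" .
qed (use M in \<open>auto simp: coeff_mat_def\<close>)

text \<open>
  The first \<open>b\<close> columns form a matrix \<open>F\<close> with \<open>M = F R\<close>, where \<open>R\<close> is the coefficient matrix. A left
  inverse \<open>Z\<close> of \<open>F\<close> recovers \<open>R\<close> from \<open>M\<close> as \<open>Z M = Z F R = R\<close>, which makes \<open>R\<close> available as a left
  multiple of \<open>M\<close>.
\<close>

lemma basis_cols_factorisation: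
  fixes M :: "complex mat"
  assumes M: "M \<in> carrier_mat p q" and b: "b \<le> q"
    and indpt: "vec_space.lin_indpt_list p (take b (cols M))"
    and \<beta>: "\<And>j. j \<in> {b..<q} \<Longrightarrow>
      col M j = finsum_vec TYPE(complex) p (\<lambda>k. \<beta> k j \<cdot>\<^sub>v col M k) {..<b}"
  obtains Z where "Z \<in> carrier_mat b p" "Z * M = coeff_mat b q \<beta>"
    "M * selection_mat q b * coeff_mat b q \<beta> = M"
proof -
  have F: "M * selection_mat q b \<in> carrier_mat p b"
    using M by (meson mult_carrier_mat selection_mat_carrier)
  from left_inverse_if_lin_indpt_cols[OF F] indpt cols_mult_selection_mat[OF M b]
  obtain Z where Z: "Z \<in> carrier_mat b p" "Z * (M * selection_mat q b) = 1\<^sub>m b"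
    by metis
  have MR: "M * selection_mat q b * coeff_mat b q \<beta> = M"
    using M b \<beta> by (rule mult_coeff_mat)
  have "Z * M = Z * (M * selection_mat q b) * coeff_mat b q \<beta>"
    using assoc_mult_mat[OF Z(1) F coeff_mat_carrier, of q \<beta>] MR by simp
  also have "\<dots> = coeff_mat b q \<beta>"
    using Z(2) left_mult_one_mat[OF coeff_mat_carrier] by metis
  finally show thesis
    using that Z(1) MR by blast
qed

lemma basis_rows_factorisation:
  fixes M :: "complex mat"
  assumes M: "M \<in> carrier_mat m n" and a: "a \<le> m"
    and indpt: "vec_space.lin_indpt_list n (take a (rows M))"
    and \<alpha>: "\<And>i. i \<in> {a..<m} \<Longrightarrow>
      row M i = finsum_vec TYPE(complex) n (\<lambda>l. \<alpha> i l \<cdot>\<^sub>v row M l) {..<a}"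
  obtains Z where "Z \<in> carrier_mat n a" "M * Z = (coeff_mat a m (\<lambda>l i. \<alpha> i l))\<^sup>T"
    "(coeff_mat a m (\<lambda>l i. \<alpha> i l))\<^sup>T * ((selection_mat m a)\<^sup>T * M) = M"
proof -
  let ?R = "coeff_mat a m (\<lambda>l i. \<alpha> i l)"
  have MT: "M\<^sup>T \<in> carrier_mat n m"
    using M by simp
  have "col M\<^sup>T i = finsum_vec TYPE(complex) n (\<lambda>l. \<alpha> i l \<cdot>\<^sub>v col M\<^sup>T l) {..<a}"
    if i: "i \<in> {a..<m}" for i
  proof -
    have "col M\<^sup>T i = finsum_vec TYPE(complex) n (\<lambda>l. \<alpha> i l \<cdot>\<^sub>v row M l) {..<a}"
      using \<alpha>[OF i] M i by simp
    also have "\<dots> = finsum_vec TYPE(complex) n (\<lambda>l. \<alpha> i l \<cdot>\<^sub>v col M\<^sup>T l) {..<a}"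
      unfolding finsum_vec_def
      by (rule comm_monoid.finprod_cong'[OF comm_monoid_vec]) (use M a in \<open>auto simp: monoid_vec_simps intro!: carrier_vecI\<close>)
    finally show ?thesis .
  qed
  then obtain Z where Z: "Z \<in> carrier_mat a n" "Z * M\<^sup>T = ?R"
    "M\<^sup>T * selection_mat m a * ?R = M\<^sup>T"
    using basis_cols_factorisation[OF MT a, of "\<lambda>l i. \<alpha> i l"] indpt by auto
  show thesis
  proof (rule that)
    show "Z\<^sup>T \<in> carrier_mat n a" using Z by simp
    show "M * Z\<^sup>T = ?R\<^sup>T"
      using transpose_mult[OF Z(1) MT] Z(2) by simp
    have "(M\<^sup>T * selection_mat m a * ?R)\<^sup>T = ?R\<^sup>T * (M\<^sup>T * selection_mat m a)\<^sup>T"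
      by (rule transpose_mult[OF mult_carrier_mat[OF MT selection_mat_carrier] coeff_mat_carrier])
    then show "?R\<^sup>T * ((selection_mat m a)\<^sup>T * M) = M"
      using transpose_mult[OF MT selection_mat_carrier, of a] Z(3) by simp
  qed
qed

section \<open>Inverses and equivalence of matrices\<close>

lemma permutation_mat_inverse:
  fixes P :: "'a :: field mat"
  assumes "permutation_mat n P"
  shows "P \<in> carrier_mat n n" "P * P\<^sup>T = 1\<^sub>m n" "P\<^sup>T * P = 1\<^sub>m n"
proof -
  obtain \<sigma> where \<sigma>: "\<sigma> permutes {..<n}" and P: "P = mat n n (\<lambda>(i, j). if j = \<sigma> i then 1 else 0)"
    using assms by (auto simp: permutation_mat_def)
  show carrier: "P \<in> carrier_mat n n"
    by (simp add: P)
  have "\<sigma> i < n" if "i < n" for i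
    using permutes_in_image[OF \<sigma>, of i] that by simp
  moreover have "\<sigma> i = \<sigma> j \<longleftrightarrow> i = j" for i j
    using permutes_inj[OF \<sigma>] by (auto simp: inj_eq)
  ultimately show PPT: "P * P\<^sup>T = 1\<^sub>m n"
    by (intro eq_matI) (auto simp: P scalar_prod_def if_distrib[of "(*) _"] cong: if_cong)
  show "P\<^sup>T * P = 1\<^sub>m n"
    using mat_mult_left_right_inverse[OF carrier _ PPT] carrier by simp
qed

lemma one_inverse_if_equivalent:
  fixes M :: "'a :: semiring_1 mat"
  assumes M: "M \<in> carrier_mat m n"
    and P: "P \<in> carrier_mat m m" "P' \<in> carrier_mat m m" "P' * P = 1\<^sub>m m"
    and Q: "Q \<in> carrier_mat n n" "Q' \<in> carrier_mat n n" "Q * Q' = 1\<^sub>m n"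
    and X: "one_inverse (P * M * Q) X"
  shows "one_inverse M (Q * X * P)"
proof -
  have X': "X \<in> carrier_mat n m" and eq: "P * M * Q * X * (P * M * Q) = P * M * Q"
    using X M P Q by (auto simp: one_inverse_def)
  note dims = carrier_matD[OF M] carrier_matD[OF P(1)] carrier_matD[OF P(2)]
    carrier_matD[OF Q(1)] carrier_matD[OF Q(2)] carrier_matD[OF X']
  have undo: "P' * (P * N * Q) * Q' = N" if N: "N \<in> carrier_mat m n" for N
  proof -
    have "P' * (P * N * Q) * Q' = P' * P * N * (Q * Q')"
      using N by (simp add: mult_mat_assoc dims)
    then show ?thesis
      using N P Q by simp
  qed
  have "M * (Q * X * P) * M = P' * (P * (M * (Q * X * P) * M) * Q) * Q'"
    by (rule undo[symmetric]) (use M P Q X' in auto)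
  also have "P * (M * (Q * X * P) * M) * Q = P * M * Q * X * (P * M * Q)"
    by (simp add: mult_mat_assoc dims)
  finally have "M * (Q * X * P) * M = M"
    using eq undo[OF M] by simp
  then show ?thesis
    using M P Q X' by (auto simp: one_inverse_def)
qed

text \<open>
  Penrose's solvability criterion for \<open>A U B = C\<close>. In one direction the given inverses supply \<open>U = X C Y\<close>;
  in the other, every pair of inverses is absorbed by the factors \<open>A\<close> and \<open>B\<close> of \<open>C\<close>.
\<close>

lemma one_inverse_condition_iff:
  fixes A B C :: "'a :: semiring_1 mat"
  assumes A: "A \<in> carrier_mat m n" and B: "B \<in> carrier_mat p q"
    and X: "one_inverse A X" and Y: "one_inverse B Y"
    and C: "C \<in> carrier_mat m q"
  shows "(\<forall>X Y. one_inverse A X \<longrightarrow> one_inverse B Y \<longrightarrow> A * X * C * Y * B = C) \<longleftrightarrow>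
    (\<exists>U \<in> carrier_mat n p. C = A * U * B)"
proof
  have *: "X \<in> carrier_mat n m" "Y \<in> carrier_mat q p"
    using X Y A B by (auto simp: one_inverse_def)
  assume "\<forall>X Y. one_inverse A X \<longrightarrow> one_inverse B Y \<longrightarrow> A * X * C * Y * B = C"
  then have "A * X * C * Y * B = C"
    using X Y by blast
  then have "C = A * (X * C * Y) * B"
    using * A B C by (simp add: mult_mat_assoc)
  moreover have "X * C * Y \<in> carrier_mat n p"
    using * C by simp
  ultimately show "\<exists>U \<in> carrier_mat n p. C = A * U * B"
    by blast
next
  assume "\<exists>U \<in> carrier_mat n p. C = A * U * B"
  then obtain U where U: "U \<in> carrier_mat n p" "C = A * U * B" by blast
  show "\<forall>X Y. one_inverse A X \<longrightarrow> one_inverse B Y \<longrightarrow> A * X * C * Y * B = C"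
  proof (intro allI impI)
    fix X Y assume "one_inverse A X" "one_inverse B Y"
    then have *: "X \<in> carrier_mat n m" "Y \<in> carrier_mat q p" "A * X * A = A" "B * Y * B = B"
      using A B by (auto simp: one_inverse_def)
    have "A * X * C * Y * B = A * X * A * U * (B * Y * B)"
      unfolding U(2) using *(1,2) A B U(1) by (simp add: mult_mat_assoc)
    then show "A * X * C * Y * B = C"
      using * U(2) by simp
  qed
qed

section \<open>The block form of the solvable right-hand sides\<close>

text \<open>
  Left of the boundary \<open>b\<close> the columns of \<open>[I | \<beta>]\<close>, and above the boundary \<open>a\<close> the rows of the transposed
  factor, are unit vectors, so the corresponding sum collapses to one term.
\<close>

lemma coeff_mat_product_index:
  fixes c :: "nat \<Rightarrow> nat \<Rightarrow> 'a :: comm_semiring_1"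
  assumes i: "i < m" and j: "j < q"
  shows "((coeff_mat a m (\<lambda>l i. \<alpha> i l))\<^sup>T * mat a b (\<lambda>(l, k). c l k) * coeff_mat b q \<beta>) $$ (i, j) =
    (if i < a \<and> j < b then c i j
     else if i < a then (\<Sum>k<b. \<beta> k j * c i k)
     else if j < b then (\<Sum>l<a. \<alpha> i l * c l j)
     else (\<Sum>l<a. \<Sum>k<b. \<alpha> i l * \<beta> k j * c l k))"
proof -
  let ?L = "coeff_mat a m (\<lambda>l i. \<alpha> i l)" and ?R = "coeff_mat b q \<beta>"
  have "(?L\<^sup>T * mat a b (\<lambda>(l, k). c l k) * ?R) $$ (i, j)
      = (?L\<^sup>T * (mat a b (\<lambda>(l, k). c l k) * ?R)) $$ (i, j)"
    by (simp add: mult_mat_assoc coeff_mat_def)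
  also have "\<dots> = (\<Sum>l<a. ?L $$ (l, i) * (\<Sum>k<b. c l k * ?R $$ (k, j)))"
    using i j by (simp add: scalar_prod_def lessThan_atLeast0 coeff_mat_def)
  also have "\<dots> = (\<Sum>l<a. ?L $$ (l, i) * (if j < b then c l j else (\<Sum>k<b. \<beta> k j * c l k)))"
    using j by (intro sum.cong)
      (auto simp: coeff_mat_def if_distrib[of "(*) _"] mult.commute cong: if_cong)
  also have "\<dots> = (if i < a then (if j < b then c i j else (\<Sum>k<b. \<beta> k j * c i k))
      else (\<Sum>l<a. \<alpha> i l * (if j < b then c l j else (\<Sum>k<b. \<beta> k j * c l k))))"
    using i by (simp add: coeff_mat_def if_distrib[of "\<lambda>x. x * _"] cong: if_cong)
  finally show ?thesis
    by (simp add: sum_distrib_left mult.assoc)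
qed

theorem theorem2p2:
  fixes A B C Ah Bh Ch T_Ar T_Ac T_Br T_Bc :: "complex mat"
    and m n p q a b :: nat
    and \<alpha> \<alpha>' \<beta> \<beta>' :: "nat \<Rightarrow> nat \<Rightarrow> complex"
  assumes A: "A \<in> carrier_mat m n" and rank_A: "vec_space.rank m A = a"
    and B: "B \<in> carrier_mat p q" and rank_B: "vec_space.rank p B = b"
    and C: "C \<in> carrier_mat m q"
    and T_Ar: "permutation_mat m T_Ar" and T_Ac: "permutation_mat n T_Ac"
    and T_Br: "permutation_mat p T_Br" and T_Bc: "permutation_mat q T_Bc"
    and Ah: "Ah = T_Ar * A * T_Ac"
    and Bh: "Bh = T_Br * B * T_Bc"
    and Ch: "Ch = T_Ar * C * T_Bc"
    and rows_Ah: "vec_space.lin_indpt_list n (take a (rows Ah))"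
    and cols_Ah: "vec_space.lin_indpt_list m (take a (cols Ah))"
    and rows_Bh: "vec_space.lin_indpt_list q (take b (rows Bh))"
    and cols_Bh: "vec_space.lin_indpt_list p (take b (cols Bh))"
    and \<alpha>: "\<And>i. i \<in> {a..<m} \<Longrightarrow>
      row Ah i = finsum_vec TYPE(complex) n (\<lambda>l. \<alpha> i l \<cdot>\<^sub>v row Ah l) {..<a}"
    and \<alpha>': "\<And>j. j \<in> {a..<n} \<Longrightarrow>
      col Ah j = finsum_vec TYPE(complex) m (\<lambda>k. \<alpha>' k j \<cdot>\<^sub>v col Ah k) {..<a}"
    and \<beta>': "\<And>i. i \<in> {b..<p} \<Longrightarrow>
      row Bh i = finsum_vec TYPE(complex) q (\<lambda>l. \<beta>' i l \<cdot>\<^sub>v row Bh l) {..<b}"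
    and \<beta>: "\<And>j. j \<in> {b..<q} \<Longrightarrow>
      col Bh j = finsum_vec TYPE(complex) p (\<lambda>k. \<beta> k j \<cdot>\<^sub>v col Bh k) {..<b}"
  shows "(\<forall>X Y. one_inverse A X \<longrightarrow> one_inverse B Y \<longrightarrow> A * X * C * Y * B = C) \<longleftrightarrow>
    (\<exists>c :: nat \<Rightarrow> nat \<Rightarrow> complex. \<forall>i<m. \<forall>j<q.
      Ch $$ (i, j) =
        (if i < a \<and> j < b then c i j
         else if i < a then (\<Sum>k<b. \<beta> k j * c i k)
         else if j < b then (\<Sum>l<a. \<alpha> i l * c l j)
         else (\<Sum>l<a. \<Sum>k<b. \<alpha> i l * \<beta> k j * c l k)))"
proof -
  note P = permutation_mat_inverse[OF T_Ar] and Q = permutation_mat_inverse[OF T_Ac]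
    and P2 = permutation_mat_inverse[OF T_Br] and Q2 = permutation_mat_inverse[OF T_Bc]
  have Ah_car: "Ah \<in> carrier_mat m n" and Bh_car: "Bh \<in> carrier_mat p q"
    and Ch_car: "Ch \<in> carrier_mat m q"
    using A B C P(1) Q(1) P2(1) Q2(1) by (auto simp: Ah Bh Ch)
  have "a \<le> n" using vec_space.rank_le_nc[OF A] rank_A by simp
  have b: "b \<le> q" using vec_space.rank_le_nc[OF B] rank_B by simp
  \<comment> \<open>The first \<open>a\<close> columns are \<open>a\<close> independent vectors of a space of dimension \<open>m\<close>; here \<open>a \<le> n\<close>
    ensures that there are \<open>a\<close> of them.\<close>
  have a: "a \<le> m"
  proof -
    interpret vec_space "TYPE(complex)" m .
    have "card (set (take a (cols Ah))) = a"
      using cols_Ah \<open>a \<le> n\<close> Ah_car by (simp add: lin_indpt_list_def distinct_card)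
    then show ?thesis
      using li_le_dim(2)[of "set (take a (cols Ah))"] cols_Ah
      by (simp add: lin_indpt_list_def dim_is_n)
  qed
  define L where "L = (coeff_mat a m (\<lambda>l i. \<alpha> i l))\<^sup>T"
  define R where "R = coeff_mat b q \<beta>"
  define S where "S = (selection_mat m a :: complex mat)\<^sup>T"
  define E where "E = (selection_mat q b :: complex mat)"
  have L_car: "L \<in> carrier_mat m a" and R_car: "R \<in> carrier_mat b q"
    and S_car: "S \<in> carrier_mat a m" and E_car: "E \<in> carrier_mat q b"
    by (auto simp: L_def R_def S_def E_def)
  obtain V where V: "V \<in> carrier_mat n a" "Ah * V = L" "L * (S * Ah) = Ah"
    using basis_rows_factorisation[OF Ah_car a rows_Ah \<alpha>] unfolding L_def S_def by blast
  obtain W where W: "W \<in> carrier_mat b p" "W * Bh = R" "Bh * E * R = Bh"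
    using basis_cols_factorisation[OF Bh_car b cols_Bh \<beta>] unfolding R_def E_def by blast
  note dims = carrier_matD[OF A] carrier_matD[OF B] carrier_matD[OF C]
    carrier_matD[OF Ah_car] carrier_matD[OF Bh_car] carrier_matD[OF Ch_car]
    carrier_matD[OF P(1)] carrier_matD[OF Q(1)] carrier_matD[OF P2(1)] carrier_matD[OF Q2(1)]
    carrier_matD[OF L_car] carrier_matD[OF R_car] carrier_matD[OF S_car] carrier_matD[OF E_car]
    carrier_matD[OF V(1)] carrier_matD[OF W(1)]

  have "Ah * (V * S) * Ah = Ah"
    using V(2,3) by (simp add: mult_mat_assoc[symmetric] dims)
  then have "one_inverse Ah (V * S)"
    using V(1) S_car by (simp add: one_inverse_def dims)
  then have inv_A: "one_inverse A (T_Ac * (V * S) * T_Ar)"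
    unfolding Ah using A P Q
    by (intro one_inverse_if_equivalent[where P' = "T_Ar\<^sup>T" and Q' = "T_Ac\<^sup>T"]) auto
  have "Bh * (E * W) * Bh = Bh"
    using W(2,3) by (simp add: mult_mat_assoc dims)
  then have "one_inverse Bh (E * W)"
    using W(1) E_car by (simp add: one_inverse_def dims)
  then have inv_B: "one_inverse B (T_Bc * (E * W) * T_Br)"
    unfolding Bh using B P2 Q2
    by (intro one_inverse_if_equivalent[where P' = "T_Br\<^sup>T" and Q' = "T_Bc\<^sup>T"]) auto

  have "(\<exists>U \<in> carrier_mat n p. C = A * U * B) \<longleftrightarrow> (\<exists>c \<in> carrier_mat a b. Ch = L * c * R)"
  proof
    assume "\<exists>U \<in> carrier_mat n p. C = A * U * B"
    then obtain U where U: "U \<in> carrier_mat n p" "C = A * U * B" by blast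
    note dims = dims carrier_matD[OF U(1)]
    define U' where "U' = T_Ac\<^sup>T * U * T_Br\<^sup>T"
    have U'_car: "U' \<in> carrier_mat n p"
      using U Q P2 by (simp add: U'_def)
    \<comment> \<open>Each identity matrix is the place where a permutation matrix meets its inverse,
      turning \<open>A\<close> and \<open>B\<close> into \<open>Ah\<close> and \<open>Bh\<close>.\<close>
    have "Ch = T_Ar * A * 1\<^sub>m n * U * 1\<^sub>m p * B * T_Bc"
      using A by (simp add: Ch U(2) mult_mat_assoc dims)
    also have "\<dots> = Ah * U' * Bh"
      by (simp add: Q(2)[symmetric] P2(3)[symmetric] Ah Bh U'_def mult_mat_assoc dims)
    also have "\<dots> = L * (S * Ah) * U' * (Bh * E * R)"
      by (simp add: V(3) W(3))
    also have "\<dots> = L * (S * Ah * U' * Bh * E) * R"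
      by (simp add: mult_mat_assoc dims carrier_matD[OF U'_car])
    finally show "\<exists>c \<in> carrier_mat a b. Ch = L * c * R"
      using S_car Ah_car U'_car Bh_car E_car
      by (intro bexI[of _ "S * Ah * U' * Bh * E"]) auto
  next
    assume "\<exists>c \<in> carrier_mat a b. Ch = L * c * R"
    then obtain c where c: "c \<in> carrier_mat a b" "Ch = L * c * R" by blast
    note dims = dims carrier_matD[OF c(1)]
    define U where "U = T_Ac * V * c * W * T_Br"
    have "C = 1\<^sub>m m * C * 1\<^sub>m q"
      using C by simp
    also have "\<dots> = T_Ar\<^sup>T * Ch * T_Bc\<^sup>T"
      by (simp add: P(3)[symmetric] Q2(2)[symmetric] Ch mult_mat_assoc dims)
    also have "\<dots> = T_Ar\<^sup>T * (Ah * V * c * (W * Bh)) * T_Bc\<^sup>T"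
      by (simp add: c V(2) W(2))
    also have "\<dots> = T_Ar\<^sup>T * T_Ar * A * U * B * (T_Bc * T_Bc\<^sup>T)"
      by (simp add: Ah Bh U_def mult_mat_assoc dims)
    also have "\<dots> = A * U * B"
      using A B by (simp add: P(3) Q2(2) U_def dims)
    finally have "C = A * U * B" .
    moreover have "U \<in> carrier_mat n p"
      unfolding U_def by (rule mult_carrier_mat Q(1) V(1) c(1) W(1) P2(1))+
    ultimately show "\<exists>U \<in> carrier_mat n p. C = A * U * B" by blast
  qed
  also have "\<dots> \<longleftrightarrow> (\<exists>c. Ch = L * mat a b (\<lambda>(l, k). c l k) * R)"
  proof
    assume "\<exists>c \<in> carrier_mat a b. Ch = L * c * R"
    then obtain c where c: "c \<in> carrier_mat a b" "Ch = L * c * R" by blast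
    have "mat a b (\<lambda>(l, k). c $$ (l, k)) = c"
      using c(1) by (intro eq_matI) auto
    then show "\<exists>c. Ch = L * mat a b (\<lambda>(l, k). c l k) * R"
      using c(2) by (intro exI[of _ "\<lambda>l k. c $$ (l, k)"]) simp
  qed auto
  also have "\<dots> \<longleftrightarrow> (\<exists>c. \<forall>i<m. \<forall>j<q.
      Ch $$ (i, j) = (L * mat a b (\<lambda>(l, k). c l k) * R) $$ (i, j))"
    by (auto simp: mat_eq_iff dims)
  finally show ?thesis
    unfolding one_inverse_condition_iff[OF A B inv_A inv_B C] L_def R_def
    by (simp only: coeff_mat_product_index cong: conj_cong imp_cong)
qed

end
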